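(* (Completeness.) Let $N$ be a $\beta$-normal form with $\Gamma\vdash_{SM_r}N:\sigma$, and let $(\Gamma',\sigma')=\mathtt{Infer}(N)$. Then there exists a type substitution $s$ such that $s(\Gamma')=\Gamma$ and $s(\sigma')=\sigma$.
   Context: Terms (de Bruijn): $M,N::=\underline{n}\mid (M\,N)\mid\lambda.M$, $n\in\mathbb{N}^*$; application associates to the left. A $\beta$-normal form is a term with no subterm of the form $((\lambda.M)\,N)$; these are exactly the terms $\underline{n}$, $\lambda.N'$ with $N'$ a $\beta$-normal form, and $\underline{n}\,N_1\cdots N_m$ with each $N_j$ a $\beta$-normal form. Types: $\mathcal{A}$ is a denumerable set of type variables; $\tau,\sigma\in\mathcal{T}::=\alpha\mid u\to\tau$ and $u\in\mathcal{U}::=\omega\mid u\wedge u\mid\tau$, with $\wedge$ commutative, associative and with neutral element $\omega$; $\to$ associates to the right. Contexts: $\Gamma::=nil\mid u.\Gamma$; $\omega^{k}.\Gamma$ is $\Gamma$ prefixed by $k$ copies of $\omega$. Intersection of contexts: $nil\wedge\Gamma=\Gamma\wedge nil=\Gamma$, $(u_1.\Gamma)\wedge(u_2.\Delta)=(u_1\wedge u_2).(\Gamma\wedge\Delta)$. A type substitution is a map $s:\mathcal{A}\to\mathcal{T}$, extended by $s(\omega)=\omega$, $s(u\wedge v)=s(u)\wedge s(v)$, $s(u\to\tau)=s(u)\to s(\tau)$, $s(nil)=nil$, $s(u.\Gamma)=s(u).s(\Gamma)$. System $SM_r$ derives judgements $\Gamma\vdash M:\tau$ by: (var$_r$) $(\sigma_1\to\cdots\to\sigma_n\to\alpha).nil\vdash\underline{1}:\sigma_1\to\cdots\to\sigma_n\to\alpha$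 ($n\ge0$, $\sigma_i\in\mathcal{T}$, $\alpha\in\mathcal{A}$); (varn) from $\Gamma\vdash\underline{n}:\tau$ infer $\omega.\Gamma\vdash\underline{n+1}:\tau$; ($\to_i$) from $u.\Gamma\vdash M:\tau$ infer $\Gamma\vdash\lambda.M:u\to\tau$; ($\to_i'$) from $nil\vdash M:\tau$ infer $nil\vdash\lambda.M:\omega\to\tau$; ($\to_e'$) from $\Gamma\vdash M_1:\omega\to\tau$ and $\Delta\vdash M_2:\sigma$ infer $\Gamma\wedge\Delta\vdash(M_1\,M_2):\tau$; ($\to_e$) from $\Gamma\vdash M_1:(\sigma_1\wedge\cdots\wedge\sigma_n)\to\tau$ ($n\ge1$, $\sigma_i\in\mathcal{T}$) and $\Delta^i\vdash M_2:\sigma_i$ for all $i$ infer $\Gamma\wedge\Delta^1\wedge\cdots\wedge\Delta^n\vdash(M_1\,M_2):\tau$. The algorithm $\mathtt{Infer}$ on $\beta$-normal forms: $\mathtt{Infer}(\underline{n})=(\omega^{n-1}.\alpha.nil,\alpha)$ with $\alpha$ fresh; $\mathtt{Infer}(\lambda.N')$: let $(\Gamma',\sigma)=\mathtt{Infer}(N')$; if $\Gamma'=u.\Gamma$ return $(\Gamma,u\to\sigma)$, otherwise return $(nil,\omega\to\sigma)$; $\mathtt{Infer}(\underline{n}\,N_1\cdots N_m)$ ($m\ge1$): let $(\Gamma^i,\sigma_i)=\mathtt{Infer}(N_i)$ and $\alpha$ fresh; return $((\omega^{n-1}.(\sigma_1\to\cdots\to\sigma_m\to\alpha).nil)\wedge\Gamma^1\wedge\cdots\wedge\Gamma^m,\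 \alpha)$. "Fresh" means never chosen before, so distinct calls produce disjoint sets of type variables. *)

theory Defs
  imports "HOL-Library.Multiset"
begin

text \<open>\<open>Var k\<close> is the index \<open>k + 1\<close>: indices range over the positive integers, so that
  shifting them by one leaves no junk terms.\<close>

datatype trm = Var nat | App trm trm | Lam trm

fun subterms :: "trm \<Rightarrow> trm set" where
  "subterms (Var k) = {Var k}"
| "subterms (App M N) = insert (App M N) (subterms M \<union> subterms N)"
| "subterms (Lam M) = insert (Lam M) (subterms M)"

definition beta_nf :: "trm \<Rightarrow> bool" where
  "beta_nf T \<longleftrightarrow> (\<forall>M N. App (Lam M) N \<notin> subterms T)"

type_synonym tvar = nat

text \<open>The intersection is associative and commutative with neutral element \<open>\<omega>\<close>, and it is not
  idempotent. Hence the set \<open>\<U>\<close> is the free commutative monoid over the types, that is, the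
  finite multisets of types: \<open>\<omega>\<close> is \<open>{#}\<close>, the intersection is \<open>+\<close>, and a type \<open>\<tau>\<close> regarded as
  an element of \<open>\<U>\<close> is \<open>{#\<tau>#}\<close>.\<close>

datatype ty = TVar tvar | Arr "ty multiset" ty

type_synonym ity = "ty multiset"
type_synonym ctx = "ity list"

definition arrs :: "ty list \<Rightarrow> ty \<Rightarrow> ty" where
  "arrs \<sigma>s \<tau> = foldr (\<lambda>\<sigma> \<rho>. Arr {#\<sigma>#} \<rho>) \<sigma>s \<tau>"

fun ctx_inter :: "ctx \<Rightarrow> ctx \<Rightarrow> ctx" where
  "ctx_inter [] \<Delta> = \<Delta>"
| "ctx_inter \<Gamma> [] = \<Gamma>"
| "ctx_inter (u # \<Gamma>) (v # \<Delta>) = (u + v) # ctx_inter \<Gamma> \<Delta>"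

primrec subst_ty :: "(tvar \<Rightarrow> ty) \<Rightarrow> ty \<Rightarrow> ty" where
  "subst_ty s (TVar \<alpha>) = s \<alpha>"
| "subst_ty s (Arr u \<tau>) = Arr (image_mset (subst_ty s) u) (subst_ty s \<tau>)"

definition subst_ity :: "(tvar \<Rightarrow> ty) \<Rightarrow> ity \<Rightarrow> ity" where
  "subst_ity s u = image_mset (subst_ty s) u"

definition subst_ctx :: "(tvar \<Rightarrow> ty) \<Rightarrow> ctx \<Rightarrow> ctx" where
  "subst_ctx s \<Gamma> = map (subst_ity s) \<Gamma>"

text \<open>In \<open>arr_e\<close>, the list \<open>\<Delta>s\<close> contains one context for each of the types in \<open>\<sigma>s\<close>; both lists
  are nonempty.\<close>

inductive SMr :: "ctx \<Rightarrow> trm \<Rightarrow> ty \<Rightarrow> bool" where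
  var_r: "SMr [{#arrs \<sigma>s (TVar \<alpha>)#}] (Var 0) (arrs \<sigma>s (TVar \<alpha>))"
| varn: "SMr \<Gamma> (Var k) \<tau> \<Longrightarrow> SMr ({#} # \<Gamma>) (Var (Suc k)) \<tau>"
| arr_i: "SMr (u # \<Gamma>) M \<tau> \<Longrightarrow> SMr \<Gamma> (Lam M) (Arr u \<tau>)"
| arr_i': "SMr [] M \<tau> \<Longrightarrow> SMr [] (Lam M) (Arr {#} \<tau>)"
| arr_e': "SMr \<Gamma> M1 (Arr {#} \<tau>) \<Longrightarrow> SMr \<Delta> M2 \<sigma> \<Longrightarrow> SMr (ctx_inter \<Gamma> \<Delta>) (App M1 M2) \<tau>"
| arr_e: "SMr \<Gamma> M1 (Arr (mset \<sigma>s) \<tau>) \<Longrightarrow> \<sigma>s \<noteq> [] \<Longrightarrow>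
    list_all2 (\<lambda>\<Delta> \<sigma>. SMr \<Delta> M2 \<sigma>) \<Delta>s \<sigma>s \<Longrightarrow>
    SMr (foldl ctx_inter \<Gamma> \<Delta>s) (App M1 M2) \<tau>"

text \<open>\<open>infer V N V' \<Gamma> \<sigma>\<close>: when the type variables chosen so far are those in \<open>V\<close>, a run of
  \<open>Infer\<close> on \<open>N\<close> may return \<open>(\<Gamma>, \<sigma>)\<close>, after which the chosen variables are those in \<open>V'\<close>.
  It is a relation because any variable outside the current set is an admissible fresh choice.
  \<open>infers\<close> runs \<open>Infer\<close> on the elements of a list from left to right.\<close>

inductive infer :: "tvar set \<Rightarrow> trm \<Rightarrow> tvar set \<Rightarrow> ctx \<Rightarrow> ty \<Rightarrow> bool"
  and infers :: "tvar set \<Rightarrow> trm list \<Rightarrow> tvar set \<Rightarrow> ctx list \<Rightarrow> ty list \<Rightarrow> bool"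
where
  infer_var: "\<alpha> \<notin> V \<Longrightarrow>
    infer V (Var k) (insert \<alpha> V) (replicate k {#} @ [{#TVar \<alpha>#}]) (TVar \<alpha>)"
| infer_lam: "infer V N V' (u # \<Gamma>) \<sigma> \<Longrightarrow> infer V (Lam N) V' \<Gamma> (Arr u \<sigma>)"
| infer_lam_nil: "infer V N V' [] \<sigma> \<Longrightarrow> infer V (Lam N) V' [] (Arr {#} \<sigma>)"
| infer_app: "infers V Ns V' \<Gamma>s \<sigma>s \<Longrightarrow> Ns \<noteq> [] \<Longrightarrow> \<alpha> \<notin> V' \<Longrightarrow>
    infer V (foldl App (Var k) Ns) (insert \<alpha> V')
      (foldl ctx_inter (replicate k {#} @ [{#arrs \<sigma>s (TVar \<alpha>)#}]) \<Gamma>s) (TVar \<alpha>)"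
| infers_Nil: "infers V [] V [] []"
| infers_Cons: "infer V N V' \<Gamma> \<sigma> \<Longrightarrow> infers V' Ns V'' \<Gamma>s \<sigma>s \<Longrightarrow>
    infers V (N # Ns) V'' (\<Gamma> # \<Gamma>s) (\<sigma> # \<sigma>s)"

text \<open>\<open>Infer\<close> is defined on every \<open>\<beta>\<close>-normal form, as long as only finitely many type variables
  have been chosen before.\<close>

lemma subterms_refl: "T \<in> subterms T"
  by (cases T) auto

lemma subterms_foldl_App:
  "subterms M \<subseteq> subterms (foldl App M Ns)"
  "N \<in> set Ns \<Longrightarrow> subterms N \<subseteq> subterms (foldl App M Ns)"
  by (induction Ns arbitrary: M rule: rev_induct) auto

lemma size_foldl_App: "N \<in> set Ns \<Longrightarrow> size N < size (foldl App M Ns)"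
  by (induction Ns rule: rev_induct) auto

lemma spine: "\<exists>H Ns. T = foldl App H Ns \<and> (\<forall>M N. H \<noteq> App M N)"
proof (induction T)
  case (App M N)
  then obtain H Ns where "M = foldl App H Ns" "\<forall>M N. H \<noteq> App M N" by blast
  then have "App M N = foldl App H (Ns @ [N])" by simp
  then show ?case using \<open>\<forall>M N. H \<noteq> App M N\<close> by blast
next
  case (Var k)
  have "Var k = foldl App (Var k) []" by simp
  then show ?case by blast
next
  case (Lam M)
  have "Lam M = foldl App (Lam M) []" by simp
  then show ?case by blast
qed

lemma infer_total:
  assumes "beta_nf N" "finite V"
  shows "\<exists>V' \<Gamma> \<sigma>. infer V N V' \<Gamma> \<sigma> \<and> finite V'"
  using assms
proof (induction N arbitrary: V rule: measure_induct_rule[of size])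
  case (less T)
  obtain H Ns where T: "T = foldl App H Ns" and H: "\<forall>M N. H \<noteq> App M N"
    using spine by blast
  have fresh: "\<exists>\<alpha>. \<alpha> \<notin> W" if "finite W" for W :: "tvar set"
    using that ex_new_if_finite infinite_UNIV_nat by blast
  show ?case
  proof (cases H)
    case (Var k)
    have "\<exists>V' \<Gamma>s \<sigma>s. infers W Ms V' \<Gamma>s \<sigma>s \<and> finite V'"
      if "set Ms \<subseteq> set Ns" "finite W" for Ms W
      using that
    proof (induction Ms arbitrary: W)
      case Nil
      then show ?case using infers_Nil by blast
    next
      case (Cons M Ms)
      then have M: "M \<in> set Ns" by simp
      have "size M < size T" unfolding T by (rule size_foldl_App[OF M])
      moreover have "beta_nf M"
        using subterms_foldl_App(2)[OF M, of H] less.prems(1)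
        unfolding beta_nf_def T by blast
      ultimately obtain V' \<Gamma> \<sigma> where "infer W M V' \<Gamma> \<sigma>" "finite V'"
        using less.IH Cons.prems by blast
      moreover from this(2) obtain V'' \<Gamma>s \<sigma>s where "infers V' Ms V'' \<Gamma>s \<sigma>s" "finite V''"
        using Cons.IH[of V'] Cons.prems(1) by auto
      ultimately show ?case using infers_Cons by blast
    qed
    then obtain V' \<Gamma>s \<sigma>s where r: "infers V Ns V' \<Gamma>s \<sigma>s" "finite V'"
      using less.prems by blast
    show ?thesis
    proof (cases "Ns = []")
      case True
      then have "T = Var k" using T Var by simp
      moreover obtain \<alpha> where "\<alpha> \<notin> V" using fresh less.prems(2) by blast
      ultimately show ?thesis using infer_var less.prems(2) by blast
    next
      case False
      obtain \<alpha> where "\<alpha> \<notin> V'" using fresh r(2) by blast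
      from infer_app[OF r(1) False this, of k] show ?thesis
        unfolding T Var using r(2) by blast
    qed
  next
    case (Lam M)
    have "Ns = []"
    proof (cases Ns)
      case (Cons N Ns')
      then have "subterms (App (Lam M) N) \<subseteq> subterms T"
        using T Lam subterms_foldl_App(1)[of "App (Lam M) N" Ns'] by (simp only: foldl_Cons)
      then show ?thesis using less.prems(1) subterms_refl unfolding beta_nf_def by blast
    qed
    then have T': "T = Lam M" using T Lam by simp
    then have "beta_nf M" using less.prems(1) by (auto simp: beta_nf_def)
    then obtain V' \<Gamma> \<sigma> where r: "infer V M V' \<Gamma> \<sigma>" "finite V'"
      using less.IH[of M V] less.prems(2) T' by auto
    show ?thesis
    proof (cases \<Gamma>)
      case Nil
      then show ?thesis using r T' infer_lam_nil by blast
    next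
      case (Cons u \<Delta>)
      then show ?thesis using r T' infer_lam by blast
    qed
  next
    case (App M N)
    then show ?thesis using H by blast
  qed
qed

end

theory Submission imports Defs begin

text \<open>A derivation for \<open>n N\<^sub>1 \<dots> N\<^sub>m\<close> gives the head a type \<open>\<sigma>\<^sub>1 \<rightarrow> \<dots> \<rightarrow> \<sigma>\<^sub>m \<rightarrow> \<tau>\<close> with all \<open>\<sigma>\<^sub>i\<close>
  in \<open>\<T>\<close>, by the shape of (var\<open>\<^sub>r\<close>); hence each argument is typed exactly once, as in \<open>Infer\<close>.
  By induction on the run of \<open>Infer\<close>, every substitution given on the variables chosen before
  the run can be modified on the variables chosen during it so as to produce the given
  derivation's context and type. This makes the substitutions for successive arguments
  compatible, and the fresh result variable is finally sent to \<open>\<tau>\<close>.\<close>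

lemma subst_ctx_simps [simp]:
  "subst_ctx s [] = []"
  "subst_ctx s (u # \<Gamma>) = image_mset (subst_ty s) u # subst_ctx s \<Gamma>"
  "subst_ctx s (\<Gamma> @ \<Delta>) = subst_ctx s \<Gamma> @ subst_ctx s \<Delta>"
  "subst_ctx s (replicate k {#}) = replicate k {#}"
  by (auto simp: subst_ctx_def subst_ity_def)

lemma subst_ctx_inter:
  "subst_ctx s (ctx_inter \<Gamma> \<Delta>) = ctx_inter (subst_ctx s \<Gamma>) (subst_ctx s \<Delta>)"
  by (induction \<Gamma> \<Delta> rule: ctx_inter.induct) auto

lemma subst_ctx_foldl:
  "subst_ctx s (foldl ctx_inter \<Gamma> \<Delta>s) = foldl ctx_inter (subst_ctx s \<Gamma>) (map (subst_ctx s) \<Delta>s)"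
  by (induction \<Delta>s arbitrary: \<Gamma>) (auto simp: subst_ctx_inter)

lemma arrs_simps [simp]:
  "arrs [] \<tau> = \<tau>"
  "arrs (\<sigma> # \<sigma>s) \<tau> = Arr {#\<sigma>#} (arrs \<sigma>s \<tau>)"
  "arrs (\<sigma>s @ \<rho>s) \<tau> = arrs \<sigma>s (arrs \<rho>s \<tau>)"
  by (auto simp: arrs_def)

lemma subst_ty_arrs: "subst_ty s (arrs \<sigma>s \<tau>) = arrs (map (subst_ty s) \<sigma>s) (subst_ty s \<tau>)"
  by (induction \<sigma>s) auto

lemma infer_subset:
  "infer V N V' \<Gamma> \<sigma> \<Longrightarrow> V \<subseteq> V'"
  "infers V Ns V' \<Gamma>s \<sigma>s \<Longrightarrow> V \<subseteq> V'"
  by (induction rule: infer_infers.inducts) auto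

text \<open>Every type variable in the result of a run belongs to the final set \<open>V'\<close>,
  so redefining a substitution outside \<open>V'\<close> leaves that result untouched.\<close>

lemma infer_subst_cong:
  "infer V N V' \<Gamma> \<sigma> \<Longrightarrow> \<forall>\<alpha>\<in>V'. s \<alpha> = s' \<alpha> \<Longrightarrow>
    subst_ctx s \<Gamma> = subst_ctx s' \<Gamma> \<and> subst_ty s \<sigma> = subst_ty s' \<sigma>"
  "infers V Ns V' \<Gamma>s \<sigma>s \<Longrightarrow> \<forall>\<alpha>\<in>V'. s \<alpha> = s' \<alpha> \<Longrightarrow>
    map (subst_ctx s) \<Gamma>s = map (subst_ctx s') \<Gamma>s \<and> map (subst_ty s) \<sigma>s = map (subst_ty s') \<sigma>s"
proof (induction rule: infer_infers.inducts)
  case (infer_app V Ns V' \<Gamma>s \<sigma>s \<alpha> k)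
  then have "map (subst_ctx s) \<Gamma>s = map (subst_ctx s') \<Gamma>s"
    "map (subst_ty s) \<sigma>s = map (subst_ty s') \<sigma>s" by simp_all
  then show ?case
    using infer_app.prems by (simp only: subst_ctx_foldl subst_ctx_simps) (simp add: subst_ty_arrs cong: map_cong)
next
  case (infers_Cons V N V' \<Gamma> \<sigma> Ns V'' \<Gamma>s \<sigma>s)
  then show ?case using infer_subset(2) by (metis list.simps(9) subsetD)
qed auto

lemma SMr_VarD:
  assumes "SMr \<Gamma> (Var k) \<tau>"
  shows "\<Gamma> = replicate k {#} @ [{#\<tau>#}] \<and> (\<exists>\<rho>s \<alpha>. \<tau> = arrs \<rho>s (TVar \<alpha>))"
  using assms by (induction \<Gamma> "Var k" \<tau> arbitrary: k rule: SMr.induct) auto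

text \<open>The context is described only for a singleton \<open>u\<close>, which is the only case
  that occurs on a spine headed by a variable. For the rule \<open>arr_e'\<close> that part holds
  vacuously, since there \<open>u\<close> is \<open>{#}\<close>.\<close>

lemma SMr_AppD:
  assumes "SMr \<Gamma> (App M N) \<tau>"
  obtains u \<Gamma>0 where "SMr \<Gamma>0 M (Arr u \<tau>)"
    and "\<And>\<rho>. u = {#\<rho>#} \<Longrightarrow> \<exists>\<Delta>. SMr \<Delta> N \<rho> \<and> \<Gamma> = ctx_inter \<Gamma>0 \<Delta>"
  using assms
proof cases
  case (arr_e' \<Gamma>0 \<Delta> \<sigma>)
  show ?thesis by (rule that[OF arr_e'(2)]) simp
next
  case (arr_e \<Gamma>0 \<sigma>s \<Delta>s)
  show ?thesis
  proof (rule that[OF arr_e(2)])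
    fix \<rho> assume "mset \<sigma>s = {#\<rho>#}"
    then have "\<sigma>s = [\<rho>]" by simp
    then show "\<exists>\<Delta>. SMr \<Delta> N \<rho> \<and> \<Gamma> = ctx_inter \<Gamma>0 \<Delta>"
      using arr_e by (auto simp: list_all2_Cons2)
  qed
qed

text \<open>The form \<open>arrs \<rho>s (TVar \<alpha>)\<close> of the result type is the invariant
  of the induction: it makes the domain of the next arrow a single type, so that the next argument
  has exactly one derivation.\<close>

lemma SMr_spineD:
  assumes "SMr \<Gamma> (foldl App (Var k) Ns) \<tau>"
  shows "\<exists>Ps \<rho>s \<alpha>. list_all2 (\<lambda>N (\<Delta>, \<sigma>). SMr \<Delta> N \<sigma>) Ns Ps \<and> \<tau> = arrs \<rho>s (TVar \<alpha>) \<and>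
    \<Gamma> = foldl ctx_inter (replicate k {#} @ [{#arrs (map snd Ps) \<tau>#}]) (map fst Ps)"
  using assms
proof (induction Ns arbitrary: \<Gamma> \<tau> rule: rev_induct)
  case Nil
  then show ?case using SMr_VarD by fastforce
next
  case (snoc N Ns)
  then have "SMr \<Gamma> (App (foldl App (Var k) Ns) N) \<tau>" by simp
  then obtain u \<Gamma>0 where M: "SMr \<Gamma>0 (foldl App (Var k) Ns) (Arr u \<tau>)"
    and N: "\<And>\<rho>. u = {#\<rho>#} \<Longrightarrow> \<exists>\<Delta>. SMr \<Delta> N \<rho> \<and> \<Gamma> = ctx_inter \<Gamma>0 \<Delta>"
    by (rule SMr_AppD) blast
  from snoc.IH[OF M] obtain Ps \<rho>s \<alpha> where
    Ps: "list_all2 (\<lambda>N (\<Delta>, \<sigma>). SMr \<Delta> N \<sigma>) Ns Ps" and \<rho>s: "Arr u \<tau> = arrs \<rho>s (TVar \<alpha>)" and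
    \<Gamma>0: "\<Gamma>0 = foldl ctx_inter (replicate k {#} @ [{#arrs (map snd Ps) (Arr u \<tau>)#}]) (map fst Ps)"
    by blast
  \<comment> \<open>An arrow is not a type variable, so \<open>\<rho>s\<close> is nonempty and its
    first entry is the domain.\<close>
  from \<rho>s obtain \<rho> \<rho>s' where u: "u = {#\<rho>#}" and \<tau>: "\<tau> = arrs \<rho>s' (TVar \<alpha>)"
    by (cases \<rho>s) auto
  from N[OF u] obtain \<Delta> where "SMr \<Delta> N \<rho>" "\<Gamma> = ctx_inter \<Gamma>0 \<Delta>" by blast
  then have "list_all2 (\<lambda>N (\<Delta>, \<sigma>). SMr \<Delta> N \<sigma>) (Ns @ [N]) (Ps @ [(\<Delta>, \<rho>)])"
    "\<Gamma> = foldl ctx_inter (replicate k {#} @ [{#arrs (map snd (Ps @ [(\<Delta>, \<rho>)])) \<tau>#}])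
      (map fst (Ps @ [(\<Delta>, \<rho>)]))"
    using Ps u \<Gamma>0 by (auto intro: list_all2_appendI)
  then show ?case using \<tau> by blast
qed

lemma SMr_LamD:
  assumes "SMr \<Gamma> (Lam M) \<tau>"
  obtains u \<rho> where "\<tau> = Arr u \<rho>" "SMr (u # \<Gamma>) M \<rho>"
    | \<rho> where "\<tau> = Arr {#} \<rho>" "\<Gamma> = []" "SMr [] M \<rho>"
  using assms by cases auto

lemma infer_complete:
  "infer V N V' \<Gamma>' \<sigma>' \<Longrightarrow> SMr \<Gamma> N \<sigma> \<Longrightarrow>
    \<exists>s. (\<forall>\<alpha>\<in>V. s \<alpha> = s0 \<alpha>) \<and> subst_ctx s \<Gamma>' = \<Gamma> \<and> subst_ty s \<sigma>' = \<sigma>"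
  "infers V Ns V' \<Gamma>s' \<sigma>s' \<Longrightarrow> list_all2 (\<lambda>N (\<Delta>, \<sigma>). SMr \<Delta> N \<sigma>) Ns Ps \<Longrightarrow>
    \<exists>s. (\<forall>\<alpha>\<in>V. s \<alpha> = s0 \<alpha>) \<and> map (subst_ctx s) \<Gamma>s' = map fst Ps \<and>
      map (subst_ty s) \<sigma>s' = map snd Ps"
proof (induction arbitrary: \<Gamma> \<sigma> s0 and Ps s0 rule: infer_infers.inducts)
  case (infer_var \<alpha> V k)
  let ?s = "s0(\<alpha> := \<sigma>)"
  have "subst_ctx ?s (replicate k {#} @ [{#TVar \<alpha>#}]) = \<Gamma>" "subst_ty ?s (TVar \<alpha>) = \<sigma>"
    using SMr_VarD[OF infer_var.prems] by auto
  moreover have "\<forall>\<beta>\<in>V. ?s \<beta> = s0 \<beta>" using infer_var.hyps by auto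
  ultimately show ?case by blast
next
  case (infer_lam V N V' u \<Delta> \<tau>)
  from infer_lam.prems show ?case
  proof (cases rule: SMr_LamD)
    case 1
    then show ?thesis using infer_lam.IH[OF 1(2), of s0] by auto
  next
    case 2
    \<comment> \<open>Impossible case: a substitution preserves the length of a context, so it
      cannot map \<open>u # \<Delta>\<close> to \<open>[]\<close>.\<close>
    then show ?thesis using infer_lam.IH[OF 2(3), of s0] by auto
  qed
next
  case (infer_lam_nil V N V' \<tau>)
  from infer_lam_nil.prems show ?case
  proof (cases rule: SMr_LamD)
    case 1
    \<comment> \<open>Impossible for the same reason: the image of \<open>[]\<close> is never a
      nonempty context.\<close>
    then show ?thesis using infer_lam_nil.IH[OF 1(2), of s0] by auto
  next
    case 2
    then show ?thesis using infer_lam_nil.IH[OF 2(3), of s0] by auto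
  qed
next
  case (infer_app V Ns V' \<Gamma>s \<sigma>s \<alpha> k)
  obtain Ps where Ps: "list_all2 (\<lambda>N (\<Delta>, \<sigma>). SMr \<Delta> N \<sigma>) Ns Ps"
    and \<Gamma>: "\<Gamma> = foldl ctx_inter (replicate k {#} @ [{#arrs (map snd Ps) \<sigma>#}]) (map fst Ps)"
    using SMr_spineD[OF infer_app.prems] by blast
  from infer_app.IH[OF Ps, of s0] obtain s where s: "\<forall>\<alpha>\<in>V. s \<alpha> = s0 \<alpha>"
    "map (subst_ctx s) \<Gamma>s = map fst Ps" "map (subst_ty s) \<sigma>s = map snd Ps" by blast
  let ?s = "s(\<alpha> := \<sigma>)"
  \<comment> \<open>\<open>\<alpha>\<close> was chosen outside \<open>V'\<close>, so the update does
    not disturb what \<open>s\<close> achieves on the arguments.\<close>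
  have "\<forall>\<beta>\<in>V'. ?s \<beta> = s \<beta>" using infer_app.hyps by auto
  from infer_subst_cong(2)[OF infer_app.hyps(1) this] s
  have "map (subst_ctx ?s) \<Gamma>s = map fst Ps" "map (subst_ty ?s) \<sigma>s = map snd Ps" by (simp_all only:)
  then have "subst_ctx ?s (foldl ctx_inter (replicate k {#} @ [{#arrs \<sigma>s (TVar \<alpha>)#}]) \<Gamma>s) = \<Gamma>"
    unfolding \<Gamma> by (simp only: subst_ctx_foldl subst_ctx_simps) (simp add: subst_ty_arrs)
  moreover have "\<forall>\<beta>\<in>V. ?s \<beta> = s0 \<beta>"
    using infer_app.hyps infer_subset(2)[OF infer_app.hyps(1)] s(1) by auto
  moreover have "subst_ty ?s (TVar \<alpha>) = \<sigma>" by simp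
  ultimately show ?case by blast
next
  case (infers_Nil V)
  then show ?case by auto
next
  case (infers_Cons V N V' \<Gamma>' \<sigma>' Ns V'' \<Gamma>s \<sigma>s)
  then obtain \<Delta> \<tau> Qs where Ps: "Ps = (\<Delta>, \<tau>) # Qs" and N: "SMr \<Delta> N \<tau>"
    and Qs: "list_all2 (\<lambda>N (\<Delta>, \<sigma>). SMr \<Delta> N \<sigma>) Ns Qs"
    by (auto simp: list_all2_Cons1)
  from infers_Cons.IH(1)[OF N, of s0] obtain s1 where
    s1: "\<forall>\<alpha>\<in>V. s1 \<alpha> = s0 \<alpha>" "subst_ctx s1 \<Gamma>' = \<Delta>" "subst_ty s1 \<sigma>' = \<tau>" by blast
  \<comment> \<open>Taking \<open>s1\<close> as the prescribed substitution makes \<open>s2\<close>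
    agree with it on \<open>V'\<close>, which keeps the result for the first term intact.\<close>
  from infers_Cons.IH(2)[OF Qs, of s1] obtain s2 where s2: "\<forall>\<alpha>\<in>V'. s2 \<alpha> = s1 \<alpha>"
    "map (subst_ctx s2) \<Gamma>s = map fst Qs" "map (subst_ty s2) \<sigma>s = map snd Qs" by blast
  have "subst_ctx s2 \<Gamma>' = \<Delta>" "subst_ty s2 \<sigma>' = \<tau>"
    using infer_subst_cong(1)[OF infers_Cons.hyps(1) s2(1)] s1 by simp_all
  moreover have "\<forall>\<alpha>\<in>V. s2 \<alpha> = s0 \<alpha>"
    using infer_subset(1)[OF infers_Cons.hyps(1)] s1(1) s2(1) by auto
  ultimately show ?case using s2 Ps by auto
qed

theorem theorem2p11:
  fixes N :: trm and \<Gamma> \<Gamma>' :: ctx and \<sigma> \<sigma>' :: ty and V V' :: "tvar set"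
  assumes "beta_nf N"
    and "SMr \<Gamma> N \<sigma>"
    and "infer V N V' \<Gamma>' \<sigma>'"
  shows "\<exists>s :: tvar \<Rightarrow> ty. subst_ctx s \<Gamma>' = \<Gamma> \<and> subst_ty s \<sigma>' = \<sigma>"
  using infer_complete(1)[OF assms(3,2)] by blast

end
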